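(* For any two sets $A,B\subseteq\{0,1\}^+$ satisfying $\mathcal F^{\preccurlyeq}_{(A,\mathbf{FPT})}=\mathcal F^{\preccurlyeq}_{(B,\mathbf{FPT})}$ we have $\mathcal F^{\preccurlyeq}_{(A,\mathbf{FPT})}\subseteq\mathcal F^{\preccurlyeq}_{(A\triangle B,\mathbf{FPT})}$; i.e., if for every parameterization $\eta$ we have $(A,\eta)\in\mathbf{FPT}\iff(B,\eta)\in\mathbf{FPT}$, then every $\eta$ with $(A,\eta)\in\mathbf{FPT}$ satisfies $(A\triangle B,\eta)\in\mathbf{FPT}$.
   Context: $A\triangle B=(A\setminus B)\cup(B\setminus A)$. A Turing machine $\Phi$ is a partial decision procedure for $A$ if $\Phi(x)=1\Rightarrow x\in A$ and $\Phi(x)=0\Rightarrow x\notin A$; $\mathrm{dom}(\Phi)=\{x:\Phi(x)\in\{0,1\}\}$. An $O(n^c)$-approximation for $A$ is a partial decision procedure for $A$ halting on all inputs in time $O(n^c)$. A parameter space is a nonempty set $\Omega$ with a reflexive, transitive, directed relation and an injective encoding into $\{0,1\}^+$. A parameterization over $\Omega$ is $\eta\subseteq\{0,1\}^+\times\Omega$ such that for every $x$, $\{k:(x,k)\in\eta\}$ is nonempty and upward closed; $\eta_k=\{x:(x,k)\in\eta\}$. $(A,\eta)\in\mathbf{FPT}$ if there are a constant $c$, a Turing machine $\Psi$ with two inputs and a computable $f$ such that for every parameter value $k$, $\Psi(k,\cdot)$ is an $O(n^c)$-approximation for $A$ with domain $\eta_k$ and running time at most $f(k)\cdot n^c$. $\mathcal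 F^{\preccurlyeq}_{(A,\mathbf{FPT})}$ denotes the set of parameterizations $\eta$ with $(A,\eta)\in\mathbf{FPT}$. *)

theory Defs
  imports Main
begin

section \<open>Multi-tape Turing machines\<close>

text \<open>
  Binary words are Boolean lists, with \<open>False\<close> for 0 and \<open>True\<close> for 1.
  Machines are deterministic with finitely many two-way infinite tapes.  States and auxiliary
  tape symbols are drawn from countable supplies; \<open>turing_machine\<close> restricts each machine to
  finitely many of them.
\<close>

type_synonym word = "bool list"

definition nonempty_words :: "word set" where
  "nonempty_words = {w. w \<noteq> []}"

datatype symbol = Blank | is_Bit: Bit (bit_of: bool) | Aux nat

datatype move = MoveLeft | Stay | MoveRight

type_synonym tape = "(int \<Rightarrow> symbol) \<times> int"

type_synonym config = "nat \<times> tape list"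

record tm =
  tapes :: nat
  states :: "nat set"
  symbols :: "symbol set"
  start_state :: nat
  halt_state :: nat
  delta :: "nat \<Rightarrow> symbol list \<Rightarrow> nat \<times> (symbol \<times> move) list"

text \<open>Here \<open>m\<close> is the number of inputs, each of which is given on a tape of its own.\<close>

definition turing_machine :: "nat \<Rightarrow> tm \<Rightarrow> bool" where
  "turing_machine m M \<longleftrightarrow>
     0 < tapes M \<and> m \<le> tapes M \<and>
     finite (states M) \<and> start_state M \<in> states M \<and> halt_state M \<in> states M \<and>
     finite (symbols M) \<and> {Blank, Bit False, Bit True} \<subseteq> symbols M \<and>
     (\<forall>q \<in> states M - {halt_state M}. \<forall>ss. length ss = tapes M \<and> set ss \<subseteq> symbols M \<longrightarrow>
        fst (delta M q ss) \<in> states M \<and>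
        length (snd (delta M q ss)) = tapes M \<and>
        fst ` set (snd (delta M q ss)) \<subseteq> symbols M)"

definition read_tape :: "tape \<Rightarrow> symbol" where
  "read_tape T = fst T (snd T)"

definition move_offset :: "move \<Rightarrow> int" where
  "move_offset d = (case d of MoveLeft \<Rightarrow> - 1 | Stay \<Rightarrow> 0 | MoveRight \<Rightarrow> 1)"

definition act_tape :: "tape \<Rightarrow> symbol \<times> move \<Rightarrow> tape" where
  "act_tape T a = ((fst T)(snd T := fst a), snd T + move_offset (snd a))"

definition step :: "tm \<Rightarrow> config \<Rightarrow> config" where
  "step M C =
     (if fst C = halt_state M then C
      else let r = delta M (fst C) (map read_tape (snd C))
           in (fst r, map2 act_tape (snd C) (snd r)))"

definition word_tape :: "word \<Rightarrow> tape" where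
  "word_tape w = (\<lambda>i. if 0 \<le> i \<and> i < int (length w) then Bit (w ! nat i) else Blank, 0)"

definition initial_config :: "tm \<Rightarrow> word list \<Rightarrow> config" where
  "initial_config M ws =
     (start_state M,
      map (\<lambda>i. word_tape (if i < length ws then ws ! i else [])) [0..<tapes M])"

definition config_at :: "tm \<Rightarrow> word list \<Rightarrow> nat \<Rightarrow> config" where
  "config_at M ws t = (step M ^^ t) (initial_config M ws)"

definition tm_halts :: "tm \<Rightarrow> word list \<Rightarrow> bool" where
  "tm_halts M ws \<longleftrightarrow> (\<exists>t. fst (config_at M ws t) = halt_state M)"

text \<open>Meaningful only when \<open>M\<close> halts on \<open>ws\<close>.\<close>

definition tm_time :: "tm \<Rightarrow> word list \<Rightarrow> nat" where
  "tm_time M ws = (LEAST t. fst (config_at M ws t) = halt_state M)"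

text \<open>
  The output is the maximal block of bits on the last tape that starts at the head position.
  Only finitely many cells of a reachable tape are non-blank, so the minimum below exists.
\<close>

definition word_at_head :: "tape \<Rightarrow> word" where
  "word_at_head T =
     map (\<lambda>i. bit_of (fst T (snd T + int i)))
       [0..<(LEAST n. \<not> is_Bit (fst T (snd T + int n)))]"

definition tm_result :: "tm \<Rightarrow> word list \<Rightarrow> word option" where
  "tm_result M ws =
     (if tm_halts M ws then Some (word_at_head (last (snd (config_at M ws (tm_time M ws)))))
      else None)"

section \<open>Partial decision procedures and approximations\<close>

text \<open>
  A machine \<open>M\<close> together with a list \<open>ps\<close> of fixed leading inputs stands for the
  one-input procedure sending \<open>x\<close> to the result of \<open>M\<close> on \<open>ps @ [x]\<close>; the procedure
  \<open>\<Psi>(k, \<cdot>)\<close> is thus given by \<open>\<Psi>\<close> and \<open>[k]\<close>.  A halting computation whose output is neither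
  of the one-letter words 0 and 1 makes no claim about \<open>x\<close>.
\<close>

definition partial_decision_procedure :: "tm \<Rightarrow> word list \<Rightarrow> word set \<Rightarrow> bool" where
  "partial_decision_procedure M ps A \<longleftrightarrow>
     (\<forall>x \<in> nonempty_words.
        (tm_result M (ps @ [x]) = Some [True] \<longrightarrow> x \<in> A) \<and>
        (tm_result M (ps @ [x]) = Some [False] \<longrightarrow> x \<notin> A))"

definition decision_domain :: "tm \<Rightarrow> word list \<Rightarrow> word set" where
  "decision_domain M ps =
     {x \<in> nonempty_words. tm_result M (ps @ [x]) \<in> {Some [False], Some [True]}}"

definition poly_approximation :: "nat \<Rightarrow> tm \<Rightarrow> word list \<Rightarrow> word set \<Rightarrow> bool" where
  "poly_approximation c M ps A \<longleftrightarrow>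
     partial_decision_procedure M ps A \<and>
     (\<forall>x \<in> nonempty_words. tm_halts M (ps @ [x])) \<and>
     (\<exists>C N. \<forall>x \<in> nonempty_words. N \<le> length x \<longrightarrow> tm_time M (ps @ [x]) \<le> C * length x ^ c)"

section \<open>Parameterizations and FPT\<close>

record 'k parameter_space =
  params :: "'k set"
  param_le :: "'k \<Rightarrow> 'k \<Rightarrow> bool"
  param_code :: "'k \<Rightarrow> word"

definition parameter_space :: "'k parameter_space \<Rightarrow> bool" where
  "parameter_space \<Omega> \<longleftrightarrow>
     params \<Omega> \<noteq> {} \<and>
     reflp_on (params \<Omega>) (param_le \<Omega>) \<and>
     transp_on (params \<Omega>) (param_le \<Omega>) \<and>
     (\<forall>k \<in> params \<Omega>. \<forall>l \<in> params \<Omega>. \<exists>m \<in> params \<Omega>. param_le \<Omega> k m \<and> param_le \<Omega> l m) \<and>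
     inj_on (param_code \<Omega>) (params \<Omega>) \<and>
     param_code \<Omega> ` params \<Omega> \<subseteq> nonempty_words"

definition parameterization :: "'k parameter_space \<Rightarrow> (word \<times> 'k) set \<Rightarrow> bool" where
  "parameterization \<Omega> \<eta> \<longleftrightarrow>
     \<eta> \<subseteq> nonempty_words \<times> params \<Omega> \<and>
     (\<forall>x \<in> nonempty_words. {k. (x, k) \<in> \<eta>} \<noteq> {} \<and>
        (\<forall>k l. (x, k) \<in> \<eta> \<and> l \<in> params \<Omega> \<and> param_le \<Omega> k l \<longrightarrow> (x, l) \<in> \<eta>))"

definition slice :: "(word \<times> 'k) set \<Rightarrow> 'k \<Rightarrow> word set" where
  "slice \<eta> k = {x. (x, k) \<in> \<eta>}"

text \<open>
  Natural numbers are output in unary.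
  Nothing is required of the machine on words that do not encode a parameter value.
\<close>

definition computable_on_params :: "'k parameter_space \<Rightarrow> ('k \<Rightarrow> nat) \<Rightarrow> bool" where
  "computable_on_params \<Omega> f \<longleftrightarrow>
     (\<exists>F. turing_machine 1 F \<and>
        (\<forall>k \<in> params \<Omega>. tm_result F [param_code \<Omega> k] = Some (replicate (f k) True)))"

definition in_FPT :: "'k parameter_space \<Rightarrow> word set \<Rightarrow> (word \<times> 'k) set \<Rightarrow> bool" where
  "in_FPT \<Omega> A \<eta> \<longleftrightarrow>
     (\<exists>c \<Psi> f. turing_machine 2 \<Psi> \<and> computable_on_params \<Omega> f \<and>
        (\<forall>k \<in> params \<Omega>.
           poly_approximation c \<Psi> [param_code \<Omega> k] A \<and>
           decision_domain \<Psi> [param_code \<Omega> k] = slice \<eta> k \<and>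
           (\<forall>x \<in> nonempty_words. tm_time \<Psi> [param_code \<Omega> k, x] \<le> f k * length x ^ c)))"

text \<open>
  A parameterization is paired with the parameter space it lives over, since \<open>\<eta>\<close> as a set of
  pairs determines neither the order nor the encoding of that space.
\<close>

definition FPT_parameterizations ::
    "word set \<Rightarrow> ('k parameter_space \<times> (word \<times> 'k) set) set" where
  "FPT_parameterizations A =
     {(\<Omega>, \<eta>). parameter_space \<Omega> \<and> parameterization \<Omega> \<eta> \<and> in_FPT \<Omega> A \<eta>}"

end

theory Submission
  imports Defs "HOL-Library.Countable"
begin

text \<open>
  Deciders for \<open>A\<close> and \<open>B\<close> that witness membership of the same \<open>\<eta>\<close> have the same domain
  in every slice, so running both in parallel on copies of the input and taking the exclusive or of the two answers
  decides \<open>A \<triangle> B\<close> on exactly that domain.  The running time is dominated by that of the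
  two deciders and by copying the input, including the parameter code \<open>k\<close>, so a computable
  function above both given bounds and above a multiple of \<open>|k|\<close> is needed.  The same
  parallel composition provides it, in a variant that outputs its own running time: a machine that
  outputs \<open>f k\<close> in unary takes at least \<open>f k - |k|\<close> steps.
\<close>

section \<open>Reachable configurations\<close>

text \<open>Nothing is known about \<open>delta\<close> outside \<open>states M\<close> and
  \<open>symbols M\<close>, so this is the invariant to carry along. It bounds all cells, not only
  the scanned ones, since a head may reach any of them later.\<close>

definition valid_config :: "tm \<Rightarrow> config \<Rightarrow> bool" where
  "valid_config M C \<longleftrightarrow> fst C \<in> states M \<and> length (snd C) = tapes M \<and>
     (\<forall>T \<in> set (snd C). range (fst T) \<subseteq> symbols M)"

lemma valid_config_initial:
  assumes "turing_machine m M"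
  shows "valid_config M (initial_config M ws)"
proof -
  have "Bit b \<in> symbols M" for b
    using assms by (cases b) (auto simp: turing_machine_def)
  then show ?thesis
    using assms by (auto simp: valid_config_def initial_config_def turing_machine_def word_tape_def)
qed

lemma valid_config_reads:
  assumes "valid_config M C"
  shows "length (map read_tape (snd C)) = tapes M" "set (map read_tape (snd C)) \<subseteq> symbols M"
  using assms by (auto simp: valid_config_def read_tape_def)

lemma delta_wellformed:
  assumes "turing_machine m M" "valid_config M C" "fst C \<noteq> halt_state M"
    and "r = delta M (fst C) (map read_tape (snd C))"
  shows "fst r \<in> states M" "length (snd r) = tapes M" "fst ` set (snd r) \<subseteq> symbols M"
  using assms valid_config_reads[OF assms(2)]
  unfolding turing_machine_def valid_config_def by blast+

lemma valid_config_step: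
  assumes "turing_machine m M" "valid_config M C"
  shows "valid_config M (step M C)"
proof (cases "fst C = halt_state M")
  case True
  then show ?thesis using assms by (simp add: step_def)
next
  case False
  define r where "r = delta M (fst C) (map read_tape (snd C))"
  note r = delta_wellformed[OF assms False r_def]
  have "range (fst T) \<subseteq> symbols M" if "T \<in> set (map2 act_tape (snd C) (snd r))" for T
  proof -
    obtain S a where "(S, a) \<in> set (zip (snd C) (snd r))" "T = act_tape S a"
      using \<open>T \<in> _\<close> by auto
    moreover from this have "S \<in> set (snd C)" "a \<in> set (snd r)"
      by (auto dest: set_zip_leftD set_zip_rightD)
    ultimately show ?thesis
      using assms(2) r(3) by (force simp: valid_config_def act_tape_def)
  qed
  then show ?thesis
    using r assms(2) False by (auto simp: valid_config_def step_def Let_def simp flip: r_def)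
qed

lemma config_at_Suc: "config_at M ws (Suc t) = step M (config_at M ws t)"
  by (simp add: config_at_def)

lemma valid_config_at:
  assumes "turing_machine m M"
  shows "valid_config M (config_at M ws t)"
proof (induction t)
  case 0
  then show ?case using valid_config_initial[OF assms] by (simp add: config_at_def)
next
  case (Suc t)
  then show ?case using valid_config_step[OF assms] by (simp add: config_at_Suc)
qed

lemma config_at_halted:
  assumes "fst (config_at M ws t) = halt_state M" "t \<le> t'"
  shows "config_at M ws t' = config_at M ws t"
  using assms(2)
proof (induction rule: dec_induct)
  case base
  show ?case ..
next
  case (step n)
  then show ?case using assms(1) by (simp add: config_at_Suc step_def)
qed

lemma halted_at_iff:
  assumes "tm_halts M ws"
  shows "fst (config_at M ws t) = halt_state M \<longleftrightarrow> tm_time M ws \<le> t"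
proof
  assume "fst (config_at M ws t) = halt_state M"
  then show "tm_time M ws \<le> t" unfolding tm_time_def by (rule Least_le)
next
  assume le: "tm_time M ws \<le> t"
  have "fst (config_at M ws (tm_time M ws)) = halt_state M"
    using assms unfolding tm_halts_def tm_time_def by (rule LeastI_ex)
  then show "fst (config_at M ws t) = halt_state M" using config_at_halted le by metis
qed

text \<open>Any halted configuration will do, not only the first: \<open>step\<close> fixes it, so
  the output may be read off at a later time.\<close>

lemma halted_at:
  assumes "config_at M ws t = C" "fst C = halt_state M"
  shows "tm_halts M ws" "tm_time M ws \<le> t" "tm_result M ws = Some (word_at_head (last (snd C)))"
proof -
  show halts: "tm_halts M ws" using assms by (auto simp: tm_halts_def)
  show le: "tm_time M ws \<le> t" using assms halted_at_iff[OF halts] by auto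
  have "config_at M ws (tm_time M ws) = C"
    using config_at_halted[OF _ le] halted_at_iff[OF halts] assms by auto
  then show "tm_result M ws = Some (word_at_head (last (snd C)))"
    using halts by (simp add: tm_result_def)
qed

section \<open>Output words\<close>

definition nonblank :: "tape \<Rightarrow> int set" where
  "nonblank T = {i. fst T i \<noteq> Blank}"

lemma nonblank_act_tape: "nonblank (act_tape T a) \<subseteq> insert (snd T) (nonblank T)"
  by (auto simp: nonblank_def act_tape_def)

definition input_word :: "word list \<Rightarrow> nat \<Rightarrow> word" where
  "input_word ws i = (if i < length ws then ws ! i else [])"

text \<open>Governs how long copying and rewinding take; the inserted 0 covers an empty list of
  inputs.\<close>

definition max_length :: "word list \<Rightarrow> nat" where
  "max_length ws = Max (insert 0 (length ` set ws))"

lemma length_input_word_le: "length (input_word ws i) \<le> max_length ws"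
  by (auto simp: input_word_def max_length_def Max_ge_iff)

lemma less_max_lengthE:
  assumes "t < max_length ws"
  obtains i where "i < length ws" "t < length (input_word ws i)"
proof -
  have "\<exists>w \<in> set ws. t < length w" using assms by (auto simp: max_length_def Max_gr_iff)
  then show ?thesis using that by (auto simp: input_word_def in_set_conv_nth)
qed

text \<open>On each tape a step writes only the scanned cell, so at most one cell per step becomes
  nonblank; initially only the cells of the input are.\<close>

lemma card_nonblank_config_at:
  assumes M: "turing_machine m M" and T: "T \<in> set (snd (config_at M ws t))"
  shows "finite (nonblank T) \<and> card (nonblank T) \<le> max_length ws + t"
  using T
proof (induction t arbitrary: T)
  case 0
  then obtain i where T: "T = word_tape (input_word ws i)"
    by (auto simp: config_at_def initial_config_def input_word_def)
  have "nonblank T \<subseteq> {0..<int (length (input_word ws i))}"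
    by (auto simp: T nonblank_def word_tape_def split: if_splits)
  then show ?case
    using length_input_word_le[of ws i] card_mono[OF _ \<open>nonblank T \<subseteq> _\<close>]
    by (auto intro: finite_subset)
next
  case (Suc t)
  let ?C = "config_at M ws t"
  have "T \<in> set (snd ?C) \<or> (\<exists>S a. S \<in> set (snd ?C) \<and> T = act_tape S a)"
    using Suc.prems
    by (fastforce simp: config_at_Suc step_def Let_def split: if_splits dest: set_zip_leftD)
  then obtain S where S: "S \<in> set (snd ?C)" "nonblank T \<subseteq> insert (snd S) (nonblank S)"
    using nonblank_act_tape by blast
  note IH = Suc.IH[OF S(1)]
  have "card (nonblank T) \<le> card (insert (snd S) (nonblank S))"
    using S(2) IH by (intro card_mono) auto
  also have "\<dots> \<le> Suc (card (nonblank S))" by (rule card_insert_le_m1) auto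
  finally show ?case using IH S(2) by (auto intro: finite_subset)
qed

definition output_length :: "tape \<Rightarrow> nat" where
  "output_length T = (LEAST n. \<not> is_Bit (fst T (snd T + int n)))"

lemma length_word_at_head: "length (word_at_head T) = output_length T"
  by (simp add: word_at_head_def output_length_def)

lemma output_length_Least:
  assumes "finite (nonblank T)"
  shows "\<not> is_Bit (fst T (snd T + int (output_length T)))"
    and "n < output_length T \<Longrightarrow> is_Bit (fst T (snd T + int n))"
proof -
  have "\<exists>n. \<not> is_Bit (fst T (snd T + int n))"
  proof (rule ccontr)
    assume "\<not> ?thesis"
    \<comment> \<open>An unbroken run of bits would make infinitely many cells nonblank.\<close>
    then have "range (\<lambda>n. snd T + int n) \<subseteq> nonblank T"
      by (force simp: nonblank_def)
    then have "finite (range (\<lambda>n. snd T + int n))" using assms by (rule finite_subset)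
    then show False by (auto dest: finite_imageD simp: inj_on_def)
  qed
  then show "\<not> is_Bit (fst T (snd T + int (output_length T)))"
    unfolding output_length_def by (rule LeastI_ex)
  show "is_Bit (fst T (snd T + int n))" if "n < output_length T"
    using not_less_Least[of n] that unfolding output_length_def by blast
qed

lemma output_length_eqI:
  assumes "\<And>i. i < n \<Longrightarrow> is_Bit (fst T (snd T + int i))" "\<not> is_Bit (fst T (snd T + int n))"
  shows "output_length T = n"
  unfolding output_length_def by (rule Least_equality) (use assms leI in blast)+

text \<open>Turns a one-letter output into a test of two adjacent cells, which a finite control can
  carry out with a single head move.\<close>

lemma word_at_head_singleton_iff:
  assumes "finite (nonblank T)"
  shows "word_at_head T = [b] \<longleftrightarrow> read_tape T = Bit b \<and> \<not> is_Bit (fst T (snd T + 1))"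
proof
  assume *: "word_at_head T = [b]"
  then have "output_length T = 1" using length_word_at_head[of T] by simp
  moreover from this have "b = bit_of (read_tape T)"
    using * by (simp add: word_at_head_def read_tape_def flip: output_length_def)
  ultimately show "read_tape T = Bit b \<and> \<not> is_Bit (fst T (snd T + 1))"
    using output_length_Least(1)[OF assms] output_length_Least(2)[OF assms, of 0]
    by (simp add: read_tape_def)
next
  assume *: "read_tape T = Bit b \<and> \<not> is_Bit (fst T (snd T + 1))"
  then have "output_length T = 1" by (intro output_length_eqI) (auto simp: read_tape_def)
  then show "word_at_head T = [b]"
    using * by (simp add: word_at_head_def read_tape_def flip: output_length_def)
qed

text \<open>All output cells are nonblank, so their number is bounded by the count of nonblank
  cells. For unary outputs this bounds the running time from below.\<close>

lemma length_result_le: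
  assumes M: "turing_machine m M" and res: "tm_result M ws = Some w"
  shows "length w \<le> max_length ws + tm_time M ws"
proof -
  define T where "T = last (snd (config_at M ws (tm_time M ws)))"
  have w: "length w = output_length T"
    using res by (auto simp: tm_result_def T_def length_word_at_head split: if_splits)
  have "snd (config_at M ws (tm_time M ws)) \<noteq> []"
    using valid_config_at[OF M, of ws "tm_time M ws"] M
    by (auto simp: valid_config_def turing_machine_def)
  then have *: "finite (nonblank T)" "card (nonblank T) \<le> max_length ws + tm_time M ws"
    using card_nonblank_config_at[OF M last_in_set] unfolding T_def by blast+
  have "(\<lambda>n. snd T + int n) ` {..<output_length T} \<subseteq> nonblank T"
    using output_length_Least(2)[OF *(1)] by (force simp: nonblank_def)
  then have "card ((\<lambda>n. snd T + int n) ` {..<output_length T}) \<le> card (nonblank T)"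
    using * by (intro card_mono)
  then show ?thesis using * w by (simp add: card_image inj_on_def)
qed

section \<open>The pair machine\<close>

text \<open>\<open>Run\<close> holds the states of both machines. \<open>Verdict v\<close> remembers
  the exclusive or while the heads inspect the cells to the right of both answers.\<close>

datatype phase = Copy | Rewind | Run nat nat | Verdict bool | Halt

instance phase :: countable
  by countable_datatype

abbreviation keep :: "symbol list \<Rightarrow> (symbol \<times> move) list" where
  "keep ss \<equiv> map (\<lambda>s. (s, Stay)) ss"

abbreviation shift :: "move \<Rightarrow> symbol list \<Rightarrow> (symbol \<times> move) list" where
  "shift d ss \<equiv> map (\<lambda>s. (s, d)) ss"

abbreviation shift_bits :: "move \<Rightarrow> symbol list \<Rightarrow> (symbol \<times> move) list" where
  "shift_bits d ss \<equiv> map (\<lambda>s. (s, if is_Bit s then d else Stay)) ss"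

text \<open>Input i lies on tape i of either block. \<open>M2\<close> may have more tapes than
  \<open>M1\<close>, and the index test leaves the surplus tapes alone.\<close>

definition copy_bits :: "symbol list \<Rightarrow> symbol list \<Rightarrow> (symbol \<times> move) list" where
  "copy_bits ss1 ss2 =
     map (\<lambda>i. if i < length ss1 \<and> is_Bit (ss1 ! i) then (ss1 ! i, MoveRight) else (ss2 ! i, Stay))
       [0..<length ss2]"

text \<open>
  The guard on the symbols is needed because the pair machine may see symbols of one machine on the
  tapes of the other, where nothing is known about \<^const>\<open>delta\<close>.
\<close>

definition guarded_delta :: "tm \<Rightarrow> nat \<Rightarrow> symbol list \<Rightarrow> nat \<times> (symbol \<times> move) list" where
  "guarded_delta M q ss =
     (if q \<noteq> halt_state M \<and> set ss \<subseteq> symbols M then delta M q ss else (q, keep ss))"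

text \<open>
  The tapes of the pair machine are those of \<open>M1\<close>, followed by those of \<open>M2\<close> and one output tape.
  If \<open>tick\<close> holds, every step writes a 1 on the output tape, so that the machine outputs its own
  running time; otherwise it outputs the exclusive or of the results.
\<close>

fun pair_action ::
    "bool \<Rightarrow> tm \<Rightarrow> tm \<Rightarrow> phase \<Rightarrow> symbol list \<Rightarrow> symbol list \<Rightarrow>
     phase \<times> (symbol \<times> move) list \<times> (symbol \<times> move) list \<times> symbol \<times> move" where
  "pair_action tick M1 M2 Copy ss1 ss2 =
     (if \<exists>s \<in> set ss1. is_Bit s
      then (Copy, shift_bits MoveRight ss1, copy_bits ss1 ss2,
            if tick then (Bit True, MoveLeft) else (Blank, Stay))
      else (Rewind, shift MoveLeft ss1, shift MoveLeft ss2,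
            if tick then (Bit True, MoveLeft) else (Blank, Stay)))"
| "pair_action tick M1 M2 Rewind ss1 ss2 =
     (if \<exists>s \<in> set ss1. is_Bit s
      then (Rewind, shift_bits MoveLeft ss1, shift_bits MoveLeft ss2,
            if tick then (Bit True, MoveLeft) else (Blank, Stay))
      else (Run (start_state M1) (start_state M2), shift MoveRight ss1, shift MoveRight ss2,
            if tick then (Bit True, MoveLeft) else (Blank, Stay)))"
| "pair_action tick M1 M2 (Run q1 q2) ss1 ss2 =
     (if q1 \<noteq> halt_state M1 \<or> q2 \<noteq> halt_state M2
      then (Run (fst (guarded_delta M1 q1 ss1)) (fst (guarded_delta M2 q2 ss2)),
            snd (guarded_delta M1 q1 ss1), snd (guarded_delta M2 q2 ss2),
            if tick then (Bit True, MoveLeft) else (Blank, Stay))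
      else if tick then (Halt, keep ss1, keep ss2, (Bit True, Stay))
      else if is_Bit (last ss1) \<and> is_Bit (last ss2)
      then (Verdict (bit_of (last ss1) \<noteq> bit_of (last ss2)),
            shift MoveRight ss1, shift MoveRight ss2, (Blank, Stay))
      else (Halt, keep ss1, keep ss2, (Blank, Stay)))"
| "pair_action tick M1 M2 (Verdict v) ss1 ss2 =
     (Halt, keep ss1, keep ss2,
      (if is_Bit (last ss1) \<or> is_Bit (last ss2) then Blank else Bit v, Stay))"
| "pair_action tick M1 M2 Halt ss1 ss2 = (Halt, keep ss1, keep ss2, (Blank, Stay))"

text \<open>States have to be natural numbers, hence the encoding by \<open>to_nat\<close>. The
  symbol scanned on the output tape is cut off by \<open>take\<close>: that tape is only
  written.\<close>

definition pair_machine :: "bool \<Rightarrow> tm \<Rightarrow> tm \<Rightarrow> tm" where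
  "pair_machine tick M1 M2 =
     \<lparr>tapes = tapes M1 + tapes M2 + 1,
      states = to_nat ` ({Copy, Rewind, Verdict False, Verdict True, Halt} \<union>
        (\<lambda>(q1, q2). Run q1 q2) ` (states M1 \<times> states M2)),
      symbols = symbols M1 \<union> symbols M2,
      start_state = to_nat Copy,
      halt_state = to_nat Halt,
      delta = (\<lambda>q ss.
        case pair_action tick M1 M2 (from_nat q) (take (tapes M1) ss)
               (take (tapes M2) (drop (tapes M1) ss))
        of (p, as1, as2, a) \<Rightarrow> (to_nat p, as1 @ as2 @ [a]))\<rparr>"

section \<open>Well-formedness of the pair machine\<close>

lemma guarded_delta_wellformed:
  assumes "turing_machine m M" "q \<in> states M" "length ss = tapes M"
  shows "fst (guarded_delta M q ss) \<in> states M"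
    and "length (snd (guarded_delta M q ss)) = tapes M"
    and "fst ` set (snd (guarded_delta M q ss)) \<subseteq> symbols M \<union> set ss"
  using assms by (auto simp: guarded_delta_def turing_machine_def image_subset_iff)

lemma pair_action_wellformed:
  assumes M: "turing_machine m M1" "turing_machine m M2"
    and len: "length ss1 = tapes M1" "length ss2 = tapes M2"
    and p: "p \<in> {Copy, Rewind, Verdict False, Verdict True, Halt} \<union>
        (\<lambda>(q1, q2). Run q1 q2) ` (states M1 \<times> states M2)"
    and act: "pair_action tick M1 M2 p ss1 ss2 = (p', as1, as2, a)"
  shows "p' \<in> {Copy, Rewind, Verdict False, Verdict True, Halt} \<union>
        (\<lambda>(q1, q2). Run q1 q2) ` (states M1 \<times> states M2)"
    and "length as1 = tapes M1" "length as2 = tapes M2"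
    and "fst ` set as1 \<union> fst ` set as2 \<union> {fst a} \<subseteq>
        symbols M1 \<union> symbols M2 \<union> set ss1 \<union> set ss2"
proof -
  have bits: "{Blank, Bit v} \<subseteq> symbols M1" for v
    using M(1) by (cases v) (auto simp: turing_machine_def)
  have start: "start_state M1 \<in> states M1" "start_state M2 \<in> states M2"
    using M by (auto simp: turing_machine_def)
  have copy: "length (copy_bits ss1 ss2) = length ss2"
    "fst ` set (copy_bits ss1 ss2) \<subseteq> set ss1 \<union> set ss2"
    by (auto simp: copy_bits_def)
  note g1 = guarded_delta_wellformed[OF M(1) _ len(1)]
  note g2 = guarded_delta_wellformed[OF M(2) _ len(2)]
  show "p' \<in> {Copy, Rewind, Verdict False, Verdict True, Halt} \<union>
        (\<lambda>(q1, q2). Run q1 q2) ` (states M1 \<times> states M2)"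
    using p act g1 g2 start by (cases p) (auto split: if_splits)
  show "length as1 = tapes M1" "length as2 = tapes M2"
    using p act g1 g2 len copy by (cases p; auto split: if_splits)+
  show "fst ` set as1 \<union> fst ` set as2 \<union> {fst a} \<subseteq>
        symbols M1 \<union> symbols M2 \<union> set ss1 \<union> set ss2"
  proof (cases p)
    case (Run q1 q2)
    then have "q1 \<in> states M1" "q2 \<in> states M2" using p by auto
    from g1(3)[OF this(1)] g2(3)[OF this(2)] show ?thesis
      using Run act bits by (auto simp: image_image split: if_splits)
  qed (use act bits copy(2) in \<open>auto simp: image_image split: if_splits\<close>)
qed

lemma turing_machine_pair_machine:
  assumes M: "turing_machine m M1" "turing_machine m M2"
  shows "turing_machine m (pair_machine tick M1 M2)"
proof -
  let ?P = "pair_machine tick M1 M2"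
  have "fst (delta ?P q ss) \<in> states ?P \<and> length (snd (delta ?P q ss)) = tapes ?P \<and>
      fst ` set (snd (delta ?P q ss)) \<subseteq> symbols ?P"
    if q: "q \<in> states ?P" and ss: "length ss = tapes ?P" "set ss \<subseteq> symbols ?P" for q ss
  proof -
    define ss1 where "ss1 = take (tapes M1) ss"
    define ss2 where "ss2 = take (tapes M2) (drop (tapes M1) ss)"
    have len: "length ss1 = tapes M1" "length ss2 = tapes M2"
      using ss(1) by (auto simp: ss1_def ss2_def pair_machine_def)
    have sub: "set ss1 \<subseteq> symbols ?P" "set ss2 \<subseteq> symbols ?P"
      using ss(2) unfolding ss1_def ss2_def by (meson order_trans set_take_subset set_drop_subset)+
    obtain p where p: "q = to_nat p" "p \<in> {Copy, Rewind, Verdict False, Verdict True, Halt} \<union>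
        (\<lambda>(q1, q2). Run q1 q2) ` (states M1 \<times> states M2)"
      using q by (auto simp: pair_machine_def)
    obtain p' as1 as2 a where act: "pair_action tick M1 M2 p ss1 ss2 = (p', as1, as2, a)"
      by (metis prod.exhaust)
    note wf = pair_action_wellformed[OF M len p(2) act]
    have "delta ?P q ss = (to_nat p', as1 @ as2 @ [a])"
      using act by (simp add: pair_machine_def p(1) ss1_def ss2_def)
    moreover have "fst ` set as1 \<union> fst ` set as2 \<union> {fst a} \<subseteq> symbols ?P"
      using wf(4) sub by (auto simp: pair_machine_def)
    ultimately show ?thesis
      using wf(1-3) by (auto simp: pair_machine_def)
  qed
  moreover have "finite (states ?P)" "finite (symbols ?P)" "0 < tapes ?P" "m \<le> tapes ?P"
    "start_state ?P \<in> states ?P" "halt_state ?P \<in> states ?P"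
    "{Blank, Bit False, Bit True} \<subseteq> symbols ?P"
    using M by (auto simp: pair_machine_def turing_machine_def)
  ultimately show ?thesis unfolding turing_machine_def by blast
qed

section \<open>Single steps and tape contents\<close>

abbreviation pair_config :: "phase \<Rightarrow> tape list \<Rightarrow> tape list \<Rightarrow> tape \<Rightarrow> config" where
  "pair_config p Ts1 Ts2 T \<equiv> (to_nat p, Ts1 @ Ts2 @ [T])"

lemma step_pair_machine:
  assumes "length Ts1 = tapes M1" "length Ts2 = tapes M2" "p \<noteq> Halt"
    and "pair_action tick M1 M2 p (map read_tape Ts1) (map read_tape Ts2) = (p', as1, as2, a)"
    and "length as1 = tapes M1" "length as2 = tapes M2"
  shows "step (pair_machine tick M1 M2) (pair_config p Ts1 Ts2 T) =
    pair_config p' (map2 act_tape Ts1 as1) (map2 act_tape Ts2 as2) (act_tape T a)"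
  using assms by (simp add: step_def pair_machine_def)

text \<open>Covers \<open>keep\<close>, \<open>shift\<close> and \<open>shift_bits\<close> at once:
  they write back the scanned symbol, so only the heads move.\<close>

lemma act_tape_rewrite:
  "map2 act_tape Ts (map (\<lambda>s. (s, d s)) (map read_tape Ts)) =
     map (\<lambda>T. (fst T, snd T + move_offset (d (read_tape T)))) Ts"
  by (induction Ts) (auto simp: act_tape_def read_tape_def)

lemma move_offset_simps [simp]:
  "move_offset MoveLeft = - 1" "move_offset Stay = 0" "move_offset MoveRight = 1"
  by (simp_all add: move_offset_def)

lemma act_tape_stay: "act_tape T (read_tape T, Stay) = T"
  by (simp add: act_tape_def read_tape_def)

text \<open>The ticks are written from right to left, so the head ends up in front of them.\<close>

definition tick_tape :: "bool \<Rightarrow> nat \<Rightarrow> tape" where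
  "tick_tape tick t =
     (if tick then (\<lambda>i. if - int t < i \<and> i \<le> 0 then Bit True else Blank, - int t)
      else word_tape [])"

lemma tick_tape_Suc:
  "act_tape (tick_tape tick t) (if tick then (Bit True, MoveLeft) else (Blank, Stay)) =
     tick_tape tick (Suc t)"
  by (auto simp: act_tape_def tick_tape_def word_tape_def)

lemma blank_stay [simp]: "act_tape (tick_tape False t) (Blank, Stay) = word_tape []"
  by (auto simp: act_tape_def tick_tape_def word_tape_def)

text \<open>The shape of all tapes of both blocks before the simulation starts; the head may stand
  outside the word.\<close>

definition placed :: "word \<Rightarrow> int \<Rightarrow> tape" where
  "placed w p = (fst (word_tape w), p)"

lemma is_Bit_placed [simp]: "is_Bit (read_tape (placed w p)) \<longleftrightarrow> 0 \<le> p \<and> p < int (length w)"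
  by (auto simp: placed_def read_tape_def word_tape_def)

lemma placed_0: "placed w 0 = word_tape w"
  by (simp add: placed_def word_tape_def)

lemma fst_snd_placed [simp]: "(fst (placed w p), q) = placed w q" "snd (placed w p) = p"
  by (simp_all add: placed_def)

lemma act_tape_copy_bit:
  assumes "t < length w"
  shows "act_tape (placed (take t w) (int t)) (read_tape (placed w (int t)), MoveRight) =
    placed (take (Suc t) w) (int (Suc t))"
  using assms by (auto simp: act_tape_def placed_def read_tape_def word_tape_def fun_eq_iff)

text \<open>On a valid configuration the guard fails only in the halting state, where
  \<open>keep\<close> agrees with \<open>step\<close> leaving everything unchanged. A machine that
  finishes first is thereby frozen.\<close>

lemma guarded_delta_step:
  assumes "turing_machine m M" "valid_config M C"
  defines "r \<equiv> guarded_delta M (fst C) (map read_tape (snd C))"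
  shows "step M C = (fst r, map2 act_tape (snd C) (snd r))" "length (snd r) = tapes M"
proof -
  note reads = valid_config_reads[OF assms(2)]
  have "map2 act_tape Ts (keep (map read_tape Ts)) = Ts" for Ts
    unfolding act_tape_rewrite by simp
  then show "step M C = (fst r, map2 act_tape (snd C) (snd r))"
    using reads by (auto simp: r_def step_def guarded_delta_def Let_def prod_eq_iff)
  show "length (snd r) = tapes M"
    unfolding r_def using assms(1,2) reads
    by (intro guarded_delta_wellformed) (auto simp: valid_config_def)
qed

section \<open>Trace of the pair machine through its phases\<close>

context
  fixes tick :: bool and M1 M2 :: tm and ws :: "word list" and m :: nat
  assumes M: "turing_machine m M1" "turing_machine m M2" and ws: "length ws = m"
begin

lemma inputs_le: "length ws \<le> tapes M1" "length ws \<le> tapes M2"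
  using M ws by (auto simp: turing_machine_def)

lemma input_word_beyond:
  "tapes M1 \<le> i \<Longrightarrow> input_word ws i = []"
  "tapes M2 \<le> i \<Longrightarrow> input_word ws i = []"
  using inputs_le by (auto simp: input_word_def)

text \<open>Loop invariant: the heads on word i advance in lockstep in both blocks and wait at its
  end, and the second block holds the prefix passed so far. Before time \<open>max_length ws\<close>
  some tape still shows a bit, so the loop goes on.\<close>

lemma config_at_copy:
  assumes "t \<le> max_length ws"
  shows "config_at (pair_machine tick M1 M2) ws t =
    pair_config Copy
      (map (\<lambda>i. placed (input_word ws i) (int (min t (length (input_word ws i))))) [0..<tapes M1])
      (map (\<lambda>i. placed (take t (input_word ws i)) (int (min t (length (input_word ws i)))))
        [0..<tapes M2])
      (tick_tape tick t)"
  using assms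
proof (induction t)
  case 0
  let ?P = "pair_machine tick M1 M2"
  have "initial_config ?P ws =
      (to_nat Copy, map (\<lambda>i. word_tape (input_word ws i)) [0..<tapes M1 + tapes M2 + 1])"
    by (simp add: initial_config_def pair_machine_def input_word_def)
  \<comment> \<open>Splits the tapes into the two blocks and the output tape. The first block has
    room for all inputs, so the shifted indices yield empty words.\<close>
  moreover have "[0..<tapes M1 + tapes M2 + 1] =
      [0..<tapes M1] @ map (\<lambda>i. i + tapes M1) [0..<tapes M2] @ [tapes M1 + tapes M2]"
    using upt_add_eq_append[of 0 "tapes M1" "tapes M2"] map_add_upt[of "tapes M1" "tapes M2"]
    by (simp add: add.commute)
  moreover have "tick_tape tick 0 = word_tape []"
    by (auto simp: tick_tape_def word_tape_def fun_eq_iff)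
  ultimately show ?case
    by (simp add: config_at_def placed_0 input_word_beyond comp_def)
next
  case (Suc t)
  define Ts1 where
    "Ts1 = map (\<lambda>i. placed (input_word ws i) (int (min t (length (input_word ws i))))) [0..<tapes M1]"
  define Ts2 where
    "Ts2 = map (\<lambda>i. placed (take t (input_word ws i)) (int (min t (length (input_word ws i)))))
        [0..<tapes M2]"
  from Suc.prems obtain i where "i < length ws" "t < length (input_word ws i)"
    by (meson Suc_le_lessD less_max_lengthE)
  then have ex: "\<exists>s \<in> set (map read_tape Ts1). is_Bit s"
    using inputs_le by (auto simp: Ts1_def intro!: bexI[of _ i])
  have 1: "map2 act_tape Ts1 (shift_bits MoveRight (map read_tape Ts1)) =
      map (\<lambda>i. placed (input_word ws i) (int (min (Suc t) (length (input_word ws i))))) [0..<tapes M1]"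
    unfolding act_tape_rewrite
    by (auto simp: Ts1_def min_def intro!: arg_cong[where f = "placed _"])
  have 2: "map2 act_tape Ts2 (copy_bits (map read_tape Ts1) (map read_tape Ts2)) =
      map (\<lambda>i. placed (take (Suc t) (input_word ws i)) (int (min (Suc t) (length (input_word ws i)))))
        [0..<tapes M2]"
  proof (rule nth_equalityI)
    fix i assume "i < length (map2 act_tape Ts2 (copy_bits (map read_tape Ts1) (map read_tape Ts2)))"
    then have i: "i < tapes M2" by (simp add: Ts2_def copy_bits_def)
    show "map2 act_tape Ts2 (copy_bits (map read_tape Ts1) (map read_tape Ts2)) ! i =
      map (\<lambda>i. placed (take (Suc t) (input_word ws i)) (int (min (Suc t) (length (input_word ws i)))))
        [0..<tapes M2] ! i"
    proof (cases "t < length (input_word ws i)")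
      case True
      \<comment> \<open>An index beyond the tapes of \<open>M1\<close> would have an empty input
        word.\<close>
      then have "i < tapes M1" using input_word_beyond[of i] by (cases "i < tapes M1") auto
      then show ?thesis
        using i True act_tape_copy_bit[OF True] by (simp add: Ts1_def Ts2_def copy_bits_def)
    next
      case False
      then show ?thesis
        using i by (auto simp: Ts1_def Ts2_def copy_bits_def act_tape_stay)
    qed
  qed (simp add: Ts2_def copy_bits_def)
  have IH: "config_at (pair_machine tick M1 M2) ws t = pair_config Copy Ts1 Ts2 (tick_tape tick t)"
    using Suc by (simp add: Ts1_def Ts2_def)
  have "step (pair_machine tick M1 M2) (pair_config Copy Ts1 Ts2 (tick_tape tick t)) =
      pair_config Copy (map2 act_tape Ts1 (shift_bits MoveRight (map read_tape Ts1)))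
        (map2 act_tape Ts2 (copy_bits (map read_tape Ts1) (map read_tape Ts2)))
        (act_tape (tick_tape tick t) (if tick then (Bit True, MoveLeft) else (Blank, Stay)))"
    by (rule step_pair_machine) (use ex in \<open>simp_all add: Ts1_def Ts2_def copy_bits_def\<close>)
  then show ?case unfolding 1 2 config_at_Suc IH tick_tape_Suc .
qed


text \<open>The step that leaves \<open>Copy\<close> already moves every head left, from the end of
  its word to the last letter, or to -1 for an empty word. Heads that reach the blank at -1 wait
  there, hence the \<open>max\<close>.\<close>

lemma config_at_rewind:
  assumes "t \<le> max_length ws"
  shows "config_at (pair_machine tick M1 M2) ws (Suc (max_length ws + t)) =
    pair_config Rewind
      (map (\<lambda>i. placed (input_word ws i) (max (- 1) (int (length (input_word ws i)) - 1 - int t)))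
        [0..<tapes M1])
      (map (\<lambda>i. placed (input_word ws i) (max (- 1) (int (length (input_word ws i)) - 1 - int t)))
        [0..<tapes M2])
      (tick_tape tick (Suc (max_length ws + t)))"
  using assms
proof (induction t)
  case 0
  define Ts where
    "Ts n = map (\<lambda>i. placed (input_word ws i) (int (length (input_word ws i)))) [0..<n]" for n
  have copied: "config_at (pair_machine tick M1 M2) ws (max_length ws) =
      pair_config Copy (Ts (tapes M1)) (Ts (tapes M2)) (tick_tape tick (max_length ws))"
    using config_at_copy[OF order_refl] length_input_word_le[of ws] by (simp add: Ts_def min_absorb2)
  have step: "step (pair_machine tick M1 M2)
        (pair_config Copy (Ts (tapes M1)) (Ts (tapes M2)) (tick_tape tick (max_length ws))) =
      pair_config Rewind
        (map2 act_tape (Ts (tapes M1)) (shift MoveLeft (map read_tape (Ts (tapes M1)))))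
        (map2 act_tape (Ts (tapes M2)) (shift MoveLeft (map read_tape (Ts (tapes M2)))))
        (act_tape (tick_tape tick (max_length ws))
          (if tick then (Bit True, MoveLeft) else (Blank, Stay)))"
    by (rule step_pair_machine) (simp_all add: Ts_def)
  have "map2 act_tape (Ts n) (shift MoveLeft (map read_tape (Ts n))) =
      map (\<lambda>i. placed (input_word ws i) (max (- 1) (int (length (input_word ws i)) - 1 - int 0)))
        [0..<n]" for n
    unfolding act_tape_rewrite by (simp add: Ts_def max_def)
  with step show ?case by (simp only: config_at_Suc copied tick_tape_Suc add_0_right)
next
  case (Suc t)
  define Ts where "Ts n = map (\<lambda>i. placed (input_word ws i)
      (max (- 1) (int (length (input_word ws i)) - 1 - int t))) [0..<n]" for n
  let ?t = "Suc (max_length ws + t)"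
  from Suc.prems obtain i where "i < length ws" "t < length (input_word ws i)"
    by (meson Suc_le_lessD less_max_lengthE)
  then have ex: "\<exists>s \<in> set (map read_tape (Ts (tapes M1))). is_Bit s"
    using inputs_le by (auto simp: Ts_def intro!: bexI[of _ i])
  have IH: "config_at (pair_machine tick M1 M2) ws ?t =
      pair_config Rewind (Ts (tapes M1)) (Ts (tapes M2)) (tick_tape tick ?t)"
    using Suc by (simp add: Ts_def)
  have step: "step (pair_machine tick M1 M2)
        (pair_config Rewind (Ts (tapes M1)) (Ts (tapes M2)) (tick_tape tick ?t)) =
      pair_config Rewind
        (map2 act_tape (Ts (tapes M1)) (shift_bits MoveLeft (map read_tape (Ts (tapes M1)))))
        (map2 act_tape (Ts (tapes M2)) (shift_bits MoveLeft (map read_tape (Ts (tapes M2)))))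
        (act_tape (tick_tape tick ?t) (if tick then (Bit True, MoveLeft) else (Blank, Stay)))"
    by (rule step_pair_machine) (use ex in \<open>simp_all add: Ts_def\<close>)
  have "map2 act_tape (Ts n) (shift_bits MoveLeft (map read_tape (Ts n))) =
      map (\<lambda>i. placed (input_word ws i)
        (max (- 1) (int (length (input_word ws i)) - 1 - int (Suc t)))) [0..<n]" for n
    unfolding act_tape_rewrite by (auto simp: Ts_def max_def intro!: arg_cong[where f = "placed _"])
  with step show ?case by (simp only: config_at_Suc[of _ _ ?t] IH tick_tape_Suc add_Suc_right)
qed

text \<open>The count consists of \<open>max_length ws\<close> steps of copying, one to turn around,
  \<open>max_length ws\<close> of rewinding, and one that moves all heads from -1 to cell 0.\<close>

lemma config_at_run_start:
  "config_at (pair_machine tick M1 M2) ws (2 * max_length ws + 2) =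
    pair_config (Run (start_state M1) (start_state M2))
      (snd (initial_config M1 ws)) (snd (initial_config M2 ws))
      (tick_tape tick (2 * max_length ws + 2))"
proof -
  define Ts where "Ts n = map (\<lambda>i. placed (input_word ws i) (- 1)) [0..<n]" for n
  let ?t = "Suc (max_length ws + max_length ws)"
  have "max (- 1) (int (length (input_word ws i)) - 1 - int (max_length ws)) = - 1" for i
    using length_input_word_le[of ws i] by simp
  then have rewound: "config_at (pair_machine tick M1 M2) ws ?t =
      pair_config Rewind (Ts (tapes M1)) (Ts (tapes M2)) (tick_tape tick ?t)"
    using config_at_rewind[OF order_refl] by (simp add: Ts_def)
  have step: "step (pair_machine tick M1 M2)
        (pair_config Rewind (Ts (tapes M1)) (Ts (tapes M2)) (tick_tape tick ?t)) =
      pair_config (Run (start_state M1) (start_state M2))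
        (map2 act_tape (Ts (tapes M1)) (shift MoveRight (map read_tape (Ts (tapes M1)))))
        (map2 act_tape (Ts (tapes M2)) (shift MoveRight (map read_tape (Ts (tapes M2)))))
        (act_tape (tick_tape tick ?t) (if tick then (Bit True, MoveLeft) else (Blank, Stay)))"
    by (rule step_pair_machine) (simp_all add: Ts_def)
  have "map2 act_tape (Ts (tapes M)) (shift MoveRight (map read_tape (Ts (tapes M)))) =
      snd (initial_config M ws)" for M
    unfolding act_tape_rewrite by (simp add: Ts_def placed_0 initial_config_def input_word_def)
  with step have "config_at (pair_machine tick M1 M2) ws (Suc ?t) =
      pair_config (Run (start_state M1) (start_state M2))
        (snd (initial_config M1 ws)) (snd (initial_config M2 ws)) (tick_tape tick (Suc ?t))"
    by (simp only: config_at_Suc[of _ _ ?t] rewound tick_tape_Suc)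
  moreover have "Suc ?t = 2 * max_length ws + 2" by simp
  ultimately show ?thesis by metis
qed

context
  assumes halts: "tm_halts M1 ws" "tm_halts M2 ws"
begin

text \<open>While either machine is running, one transition performs a step of both; the guard holds
  a machine that has already halted in place.\<close>

lemma config_at_run:
  assumes "n \<le> max (tm_time M1 ws) (tm_time M2 ws)"
  shows "config_at (pair_machine tick M1 M2) ws (2 * max_length ws + 2 + n) =
    pair_config (Run (fst (config_at M1 ws n)) (fst (config_at M2 ws n)))
      (snd (config_at M1 ws n)) (snd (config_at M2 ws n))
      (tick_tape tick (2 * max_length ws + 2 + n))"
  using assms
proof (induction n)
  case 0
  then show ?case using config_at_run_start by (simp add: config_at_def initial_config_def)
next
  case (Suc n)
  let ?t = "2 * max_length ws + 2 + n"
  define C1 C2 where "C1 = config_at M1 ws n" and "C2 = config_at M2 ws n"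
  define r1 r2 where "r1 = guarded_delta M1 (fst C1) (map read_tape (snd C1))"
    and "r2 = guarded_delta M2 (fst C2) (map read_tape (snd C2))"
  have valid: "valid_config M1 C1" "valid_config M2 C2"
    using valid_config_at M by (auto simp: C1_def C2_def)
  note r = guarded_delta_step[OF M(1) valid(1), folded r1_def]
    guarded_delta_step[OF M(2) valid(2), folded r2_def]
  have running: "fst C1 \<noteq> halt_state M1 \<or> fst C2 \<noteq> halt_state M2"
    using Suc.prems halted_at_iff[OF halts(1), of n] halted_at_iff[OF halts(2), of n]
    by (auto simp: C1_def C2_def)
  have IH: "config_at (pair_machine tick M1 M2) ws ?t =
      pair_config (Run (fst C1) (fst C2)) (snd C1) (snd C2) (tick_tape tick ?t)"
    using Suc by (simp add: C1_def C2_def)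
  have "step (pair_machine tick M1 M2)
        (pair_config (Run (fst C1) (fst C2)) (snd C1) (snd C2) (tick_tape tick ?t)) =
      pair_config (Run (fst r1) (fst r2))
        (map2 act_tape (snd C1) (snd r1)) (map2 act_tape (snd C2) (snd r2))
        (act_tape (tick_tape tick ?t) (if tick then (Bit True, MoveLeft) else (Blank, Stay)))"
    using valid running r
    by (intro step_pair_machine) (auto simp: valid_config_def simp flip: r1_def r2_def)
  then have "config_at (pair_machine tick M1 M2) ws (Suc ?t) =
      pair_config (Run (fst (step M1 C1)) (fst (step M2 C2)))
        (snd (step M1 C1)) (snd (step M2 C2)) (tick_tape tick (Suc ?t))"
    by (simp only: config_at_Suc IH r tick_tape_Suc fst_conv snd_conv)
  then show ?case by (simp add: config_at_Suc C1_def C2_def)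
qed

text \<open>\<open>C1\<close> and \<open>C2\<close> are taken at the larger of the two halting
  times; the machine that halted earlier has not changed since, so its result can still be read
  off.\<close>

lemma config_at_run_end:
  obtains C1 C2 :: config where
    "config_at (pair_machine tick M1 M2) ws
        (2 * max_length ws + 2 + max (tm_time M1 ws) (tm_time M2 ws)) =
      pair_config (Run (halt_state M1) (halt_state M2)) (snd C1) (snd C2)
        (tick_tape tick (2 * max_length ws + 2 + max (tm_time M1 ws) (tm_time M2 ws)))"
    "length (snd C1) = tapes M1" "length (snd C2) = tapes M2"
    "finite (nonblank (last (snd C1)))" "finite (nonblank (last (snd C2)))"
    "tm_result M1 ws = Some (word_at_head (last (snd C1)))"
    "tm_result M2 ws = Some (word_at_head (last (snd C2)))"
proof -
  let ?n = "max (tm_time M1 ws) (tm_time M2 ws)"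
  define C1 C2 where "C1 = config_at M1 ws ?n" and "C2 = config_at M2 ws ?n"
  have halted: "fst C1 = halt_state M1" "fst C2 = halt_state M2"
    using halted_at_iff halts by (auto simp: C1_def C2_def)
  have len: "length (snd C1) = tapes M1" "length (snd C2) = tapes M2"
    using valid_config_at M by (auto simp: C1_def C2_def valid_config_def)
  then have "snd C1 \<noteq> []" "snd C2 \<noteq> []" using M by (auto simp: turing_machine_def)
  then have "finite (nonblank (last (snd C1)))" "finite (nonblank (last (snd C2)))"
    using card_nonblank_config_at M last_in_set unfolding C1_def C2_def by blast+
  then show ?thesis
    using that[of C1 C2] config_at_run[OF order_refl] len halted
      halted_at(3)[OF C1_def[symmetric]] halted_at(3)[OF C2_def[symmetric]]
    by (simp flip: C1_def C2_def)
qed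

end

end

section \<open>Outputs of the two variants\<close>

lemma word_at_head_blank: "word_at_head (word_tape []) = []"
proof -
  have "output_length (word_tape []) = 0" by (rule output_length_eqI) (auto simp: word_tape_def)
  then show ?thesis using length_word_at_head[of "word_tape []"] by simp
qed

text \<open>The last tick is written without a move, so the head rests on the leftmost tick and the
  block to its right ends at cell 0.\<close>

lemma word_at_head_ticks:
  "word_at_head (act_tape (tick_tape True t) (Bit True, Stay)) = replicate (Suc t) True"
proof -
  let ?T = "act_tape (tick_tape True t) (Bit True, Stay)"
  have T: "fst ?T (snd ?T + int i) = (if i \<le> t then Bit True else Blank)" for i
    by (auto simp: act_tape_def tick_tape_def)
  have "output_length ?T = Suc t" by (rule output_length_eqI) (auto simp: T simp del: of_nat_Suc)
  then show ?thesis
    unfolding word_at_head_def output_length_def[symmetric]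
    by (intro nth_equalityI) (auto simp: T simp del: upt_Suc replicate_Suc)
qed

text \<open>Every step leaves one tick. Of the summand 3, two steps switch the phase and one
  halts.\<close>

lemma ticking_pair_machine:
  assumes M: "turing_machine m M1" "turing_machine m M2" and ws: "length ws = m"
    and halts: "tm_halts M1 ws" "tm_halts M2 ws"
  shows "tm_result (pair_machine True M1 M2) ws =
    Some (replicate (2 * max_length ws + 3 + max (tm_time M1 ws) (tm_time M2 ws)) True)"
proof -
  let ?t = "2 * max_length ws + 2 + max (tm_time M1 ws) (tm_time M2 ws)"
  obtain C1 C2 :: config where C: "config_at (pair_machine True M1 M2) ws ?t =
      pair_config (Run (halt_state M1) (halt_state M2)) (snd C1) (snd C2) (tick_tape True ?t)"
    and len: "length (snd C1) = tapes M1" "length (snd C2) = tapes M2"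
    using config_at_run_end[OF M ws halts] by metis
  have "step (pair_machine True M1 M2)
      (pair_config (Run (halt_state M1) (halt_state M2)) (snd C1) (snd C2) (tick_tape True ?t)) =
    pair_config Halt (map2 act_tape (snd C1) (keep (map read_tape (snd C1))))
      (map2 act_tape (snd C2) (keep (map read_tape (snd C2))))
      (act_tape (tick_tape True ?t) (Bit True, Stay))"
    by (rule step_pair_machine) (use len in simp_all)
  then have "config_at (pair_machine True M1 M2) ws (Suc ?t) =
    pair_config Halt (map2 act_tape (snd C1) (keep (map read_tape (snd C1))))
      (map2 act_tape (snd C2) (keep (map read_tape (snd C2))))
      (act_tape (tick_tape True ?t) (Bit True, Stay))"
    by (simp only: config_at_Suc C)
  from halted_at(3)[OF this] show ?thesis
    by (simp add: word_at_head_ticks pair_machine_def numeral_3_eq_3 del: replicate_Suc)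
qed

text \<open>A bit is written only if both result tapes show a bit under the head and none to its
  right. If a test fails, the output tape stays blank and the empty output makes no claim. The tests
  take at most two steps after the run.\<close>

lemma xor_pair_machine:
  assumes M: "turing_machine m M1" "turing_machine m M2" and ws: "length ws = m"
    and halts: "tm_halts M1 ws" "tm_halts M2 ws"
  defines "P \<equiv> pair_machine False M1 M2"
  shows "tm_halts P ws"
    and "tm_time P ws \<le> 2 * max_length ws + 4 + max (tm_time M1 ws) (tm_time M2 ws)"
    and "tm_result P ws = Some [b] \<longleftrightarrow>
      (\<exists>b1 b2. tm_result M1 ws = Some [b1] \<and> tm_result M2 ws = Some [b2] \<and> b = (b1 \<noteq> b2))"
proof -
  let ?t = "2 * max_length ws + 2 + max (tm_time M1 ws) (tm_time M2 ws)"
  obtain C1 C2 :: config where C: "config_at P ws ?t =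
      pair_config (Run (halt_state M1) (halt_state M2)) (snd C1) (snd C2) (tick_tape False ?t)"
    and len: "length (snd C1) = tapes M1" "length (snd C2) = tapes M2"
    and fin: "finite (nonblank (last (snd C1)))" "finite (nonblank (last (snd C2)))"
    and res: "tm_result M1 ws = Some (word_at_head (last (snd C1)))"
      "tm_result M2 ws = Some (word_at_head (last (snd C2)))"
    using config_at_run_end[OF M ws halts] unfolding P_def by metis
  define T1 T2 where "T1 = last (snd C1)" and "T2 = last (snd C2)"
  have "snd C1 \<noteq> []" "snd C2 \<noteq> []" using len M by (auto simp: turing_machine_def)
  then have last: "last (map f (snd C1)) = f T1" "last (map f (snd C2)) = f T2"
    for f :: "tape \<Rightarrow> symbol"
    by (simp_all add: T1_def T2_def last_map)
  \<comment> \<open>Expresses the two one-letter answers through the cells that the machine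
    inspects.\<close>
  have iff: "(\<exists>b1 b2. tm_result M1 ws = Some [b1] \<and> tm_result M2 ws = Some [b2] \<and> b = (b1 \<noteq> b2))
      \<longleftrightarrow> is_Bit (read_tape T1) \<and> is_Bit (read_tape T2) \<and>
        \<not> is_Bit (fst T1 (snd T1 + 1)) \<and> \<not> is_Bit (fst T2 (snd T2 + 1)) \<and>
        b = (bit_of (read_tape T1) \<noteq> bit_of (read_tape T2))"
    using fin
    by (cases "read_tape T1"; cases "read_tape T2")
       (auto simp: res word_at_head_singleton_iff simp flip: T1_def T2_def)
  have halt: "halt_state P = to_nat Halt" by (simp add: P_def pair_machine_def)
  have "tm_halts P ws \<and> tm_time P ws \<le> ?t + 2 \<and> (tm_result P ws = Some [b] \<longleftrightarrow>
      (\<exists>b1 b2. tm_result M1 ws = Some [b1] \<and> tm_result M2 ws = Some [b2] \<and> b = (b1 \<noteq> b2)))"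
  proof (cases "is_Bit (read_tape T1) \<and> is_Bit (read_tape T2)")
    case False
    have "step P
        (pair_config (Run (halt_state M1) (halt_state M2)) (snd C1) (snd C2) (tick_tape False ?t)) =
      pair_config Halt (map2 act_tape (snd C1) (keep (map read_tape (snd C1))))
        (map2 act_tape (snd C2) (keep (map read_tape (snd C2))))
        (act_tape (tick_tape False ?t) (Blank, Stay))"
      unfolding P_def by (rule step_pair_machine) (use len last False in simp_all)
    then have "config_at P ws (Suc ?t) =
      pair_config Halt (map2 act_tape (snd C1) (keep (map read_tape (snd C1))))
        (map2 act_tape (snd C2) (keep (map read_tape (snd C2)))) (word_tape [])"
      by (simp only: config_at_Suc C blank_stay)
    from halted_at[OF this] show ?thesis
      using False unfolding iff by (auto simp: halt word_at_head_blank)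
  next
    case True
    define v where "v = (bit_of (read_tape T1) \<noteq> bit_of (read_tape T2))"
    define Ts where "Ts C = map (\<lambda>T. (fst T, snd T + 1)) (snd C)" for C :: config
    have "step P
        (pair_config (Run (halt_state M1) (halt_state M2)) (snd C1) (snd C2) (tick_tape False ?t)) =
      pair_config (Verdict v) (map2 act_tape (snd C1) (shift MoveRight (map read_tape (snd C1))))
        (map2 act_tape (snd C2) (shift MoveRight (map read_tape (snd C2))))
        (act_tape (tick_tape False ?t) (Blank, Stay))"
      unfolding P_def by (rule step_pair_machine) (use len last True in \<open>simp_all add: v_def\<close>)
    moreover have "map2 act_tape (snd C) (shift MoveRight (map read_tape (snd C))) = Ts C"
      for C :: config
      unfolding act_tape_rewrite by (simp add: Ts_def)
    ultimately have C': "config_at P ws (Suc ?t) =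
        pair_config (Verdict v) (Ts C1) (Ts C2) (word_tape [])"
      by (simp only: config_at_Suc C blank_stay)
    \<comment> \<open>The heads have moved right, so the scanned cells are those after the answers;
      a bit there reveals a longer output and cancels the verdict.\<close>
    define s where "s = (if is_Bit (fst T1 (snd T1 + 1)) \<or> is_Bit (fst T2 (snd T2 + 1))
      then Blank else Bit v)"
    have "step P (pair_config (Verdict v) (Ts C1) (Ts C2) (word_tape [])) =
      pair_config Halt (map2 act_tape (Ts C1) (keep (map read_tape (Ts C1))))
        (map2 act_tape (Ts C2) (keep (map read_tape (Ts C2))))
        (act_tape (word_tape []) (s, Stay))"
      unfolding P_def
      by (rule step_pair_machine)
         (use len in \<open>simp_all add: s_def Ts_def last comp_def read_tape_def\<close>)
    then have "config_at P ws (Suc (Suc ?t)) =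
      pair_config Halt (map2 act_tape (Ts C1) (keep (map read_tape (Ts C1))))
        (map2 act_tape (Ts C2) (keep (map read_tape (Ts C2))))
        (act_tape (word_tape []) (s, Stay))"
      by (simp only: config_at_Suc[of _ _ "Suc ?t"] C')
    note halted = halted_at[OF this]
    have "nonblank (act_tape (word_tape []) (s, Stay)) \<subseteq> {0}"
      by (auto simp: nonblank_def act_tape_def word_tape_def)
    then have "finite (nonblank (act_tape (word_tape []) (s, Stay)))"
      by (rule finite_subset) simp
    then have "word_at_head (act_tape (word_tape []) (s, Stay)) = [b] \<longleftrightarrow> s = Bit b"
      by (auto simp: word_at_head_singleton_iff read_tape_def act_tape_def word_tape_def)
    then show ?thesis
      using halted True unfolding iff by (auto simp: halt s_def v_def)
  qed
  then show "tm_halts P ws"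
    and "tm_time P ws \<le> 2 * max_length ws + 4 + max (tm_time M1 ws) (tm_time M2 ws)"
    and "tm_result P ws = Some [b] \<longleftrightarrow>
      (\<exists>b1 b2. tm_result M1 ws = Some [b1] \<and> tm_result M2 ws = Some [b2] \<and> b = (b1 \<noteq> b2))"
    by simp_all
qed

section \<open>Fixed-parameter tractability\<close>

text \<open>No arithmetic on \<open>f1\<close> and \<open>f2\<close> has to be programmed: the bound
  is a measured running time, and running times dominate unary outputs up to the input
  length.\<close>

lemma computable_on_params_bound:
  assumes "computable_on_params \<Omega> f1" "computable_on_params \<Omega> f2"
  obtains g where "computable_on_params \<Omega> g"
    and "\<And>k. k \<in> params \<Omega> \<Longrightarrow> 2 * length (param_code \<Omega> k) + 4 + max (f1 k) (f2 k) \<le> g k"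
proof -
  obtain F1 F2 where F: "turing_machine 1 F1" "turing_machine 1 F2"
    and res: "\<And>k. k \<in> params \<Omega> \<Longrightarrow> tm_result F1 [param_code \<Omega> k] = Some (replicate (f1 k) True)"
      "\<And>k. k \<in> params \<Omega> \<Longrightarrow> tm_result F2 [param_code \<Omega> k] = Some (replicate (f2 k) True)"
    using assms unfolding computable_on_params_def by blast
  define G where "G = pair_machine True F1 F2"
  \<comment> \<open>\<open>G\<close> gains only \<open>|k|\<close> over \<open>f1\<close> and \<open>f2\<close>, which is not enough, so it is timed once more.\<close>
  define H where "H = pair_machine True G G"
  define g where "g k = 2 * length (param_code \<Omega> k) + 3 + tm_time G [param_code \<Omega> k]" for k
  have G: "turing_machine 1 G" and H: "turing_machine 1 H"
    using F by (simp_all add: G_def H_def turing_machine_pair_machine)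
  have len: "max_length [w] = length w" for w by (simp add: max_length_def)
  have *: "tm_result H [param_code \<Omega> k] = Some (replicate (g k) True)"
    "2 * length (param_code \<Omega> k) + 4 + max (f1 k) (f2 k) \<le> g k" if k: "k \<in> params \<Omega>" for k
  proof -
    let ?w = "param_code \<Omega> k"
    have halts: "tm_halts F1 [?w]" "tm_halts F2 [?w]"
      using res[OF k] by (auto simp: tm_result_def split: if_splits)
    have resG: "tm_result G [?w] =
        Some (replicate (2 * length ?w + 3 + max (tm_time F1 [?w]) (tm_time F2 [?w])) True)"
      unfolding G_def using ticking_pair_machine[OF F _ halts] by (simp add: len)
    then have haltsG: "tm_halts G [?w]" by (auto simp: tm_result_def split: if_splits)
    show "tm_result H [?w] = Some (replicate (g k) True)"
      unfolding H_def using ticking_pair_machine[OF G G _ haltsG haltsG] by (simp add: len g_def)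
    \<comment> \<open>One of \<open>F1\<close>, \<open>F2\<close> runs at least
      \<open>max (f1 k) (f2 k) - |k|\<close> steps. So \<open>G\<close> outputs at least
      \<open>|k| + 3 + max (f1 k) (f2 k)\<close> ones and takes at least
      \<open>3 + max (f1 k) (f2 k)\<close> steps; timing it by \<open>H\<close> adds
      \<open>2 * |k| + 3\<close>.\<close>
    show "2 * length ?w + 4 + max (f1 k) (f2 k) \<le> g k"
      using length_result_le[OF G resG] length_result_le[OF F(1) res(1)[OF k]]
        length_result_le[OF F(2) res(2)[OF k]]
      by (simp add: len g_def)
  qed
  show thesis using that[of g] * H by (auto simp: computable_on_params_def)
qed

lemma in_FPT_symmetric_difference:
  assumes \<Omega>: "parameter_space \<Omega>" and A: "in_FPT \<Omega> A \<eta>" and B: "in_FPT \<Omega> B \<eta>"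
  shows "in_FPT \<Omega> ((A - B) \<union> (B - A)) \<eta>"
proof -
  obtain c1 M1 f1 where M1: "turing_machine 2 M1" and f1: "computable_on_params \<Omega> f1"
    and A: "\<And>k. k \<in> params \<Omega> \<Longrightarrow> poly_approximation c1 M1 [param_code \<Omega> k] A \<and>
           decision_domain M1 [param_code \<Omega> k] = slice \<eta> k \<and>
           (\<forall>x \<in> nonempty_words. tm_time M1 [param_code \<Omega> k, x] \<le> f1 k * length x ^ c1)"
    using A unfolding in_FPT_def by blast
  obtain c2 M2 f2 where M2: "turing_machine 2 M2" and f2: "computable_on_params \<Omega> f2"
    and B: "\<And>k. k \<in> params \<Omega> \<Longrightarrow> poly_approximation c2 M2 [param_code \<Omega> k] B \<and>
           decision_domain M2 [param_code \<Omega> k] = slice \<eta> k \<and>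
           (\<forall>x \<in> nonempty_words. tm_time M2 [param_code \<Omega> k, x] \<le> f2 k * length x ^ c2)"
    using B unfolding in_FPT_def by blast
  obtain g where g: "computable_on_params \<Omega> g"
    and g_ge: "\<And>k. k \<in> params \<Omega> \<Longrightarrow>
      2 * length (param_code \<Omega> k) + 4 + max (f1 k) (f2 k) \<le> g k"
    using computable_on_params_bound[OF f1 f2] by blast
  define P where "P = pair_machine False M1 M2"
  \<comment> \<open>\<open>Suc\<close> makes the exponent positive, so that \<open>n ^ c\<close>
    absorbs the linear cost of copying even if \<open>c1\<close> and \<open>c2\<close> are
    0.\<close>
  define c where "c = Suc (max c1 c2)"
  have P: "turing_machine 2 P" using M1 M2 by (simp add: P_def turing_machine_pair_machine)
  have main: "poly_approximation c P [param_code \<Omega> k] ((A - B) \<union> (B - A)) \<and>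
      decision_domain P [param_code \<Omega> k] = slice \<eta> k \<and>
      (\<forall>x \<in> nonempty_words. tm_time P [param_code \<Omega> k, x] \<le> g k * length x ^ c)"
    if k: "k \<in> params \<Omega>" for k
  proof -
    let ?w = "param_code \<Omega> k"
    have halts: "tm_halts M1 [?w, x]" "tm_halts M2 [?w, x]" if "x \<in> nonempty_words" for x
      using A[OF k] B[OF k] that by (auto simp: poly_approximation_def)
    note xor = xor_pair_machine[OF M1 M2 _ halts, folded P_def, simplified]
    have time: "tm_time P [?w, x] \<le> g k * length x ^ c" if x: "x \<in> nonempty_words" for x
    proof -
      define n where "n = length x"
      have n: "1 \<le> n" using x by (simp add: n_def nonempty_words_def Suc_le_eq)
      \<comment> \<open>Parameter codes and inputs are nonempty, so the product of their lengths
        bounds the maximum.\<close>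
      have "1 \<le> length ?w"
        using \<Omega> k by (auto simp: parameter_space_def nonempty_words_def Suc_le_eq)
      then have "max_length [?w, x] \<le> length ?w * n"
        using n by (simp add: max_length_def n_def)
      also have "\<dots> \<le> length ?w * n ^ c"
        using n self_le_power[of n c] by (simp add: c_def)
      finally have len: "max_length [?w, x] \<le> length ?w * n ^ c" .
      have "tm_time M1 [?w, x] \<le> f1 k * n ^ c1" "tm_time M2 [?w, x] \<le> f2 k * n ^ c2"
        using A[OF k] B[OF k] x by (auto simp: n_def)
      moreover have "f1 k * n ^ c1 \<le> max (f1 k) (f2 k) * n ^ c"
        "f2 k * n ^ c2 \<le> max (f1 k) (f2 k) * n ^ c"
        using n by (intro mult_le_mono power_increasing; simp add: c_def)+
      ultimately have run:
        "max (tm_time M1 [?w, x]) (tm_time M2 [?w, x]) \<le> max (f1 k) (f2 k) * n ^ c"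
        by linarith
      \<comment> \<open>Absorbs the additive 4 into the coefficient that \<open>g\<close> was built
        to dominate.\<close>
      have "1 \<le> n ^ c" using n by simp
      then have "tm_time P [?w, x] \<le>
          2 * (length ?w * n ^ c) + 4 * n ^ c + max (f1 k) (f2 k) * n ^ c"
        using xor(2)[OF x x] len run by linarith
      also have "\<dots> = (2 * length ?w + 4 + max (f1 k) (f2 k)) * n ^ c"
        by (simp add: algebra_simps)
      also have "\<dots> \<le> g k * n ^ c" using g_ge[OF k] by (rule mult_le_mono1)
      finally show ?thesis by (simp add: n_def)
    qed
    \<comment> \<open>The exclusive or answers exactly when both deciders do. Both domains are the
      slice of the same \<eta>, so the intersection loses nothing.\<close>
    have "decision_domain P [?w] = decision_domain M1 [?w] \<inter> decision_domain M2 [?w]"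
      using xor(3) unfolding decision_domain_def by auto
    then have "decision_domain P [?w] = slice \<eta> k" using A[OF k] B[OF k] by simp
    moreover have "partial_decision_procedure P [?w] ((A - B) \<union> (B - A))"
      unfolding partial_decision_procedure_def
    proof (intro ballI conjI impI)
      fix x assume x: "x \<in> nonempty_words"
      have in_A: "tm_result M1 [?w, x] = Some [b] \<Longrightarrow> x \<in> A \<longleftrightarrow> b"
        and in_B: "tm_result M2 [?w, x] = Some [b] \<Longrightarrow> x \<in> B \<longleftrightarrow> b" for b
        using A[OF k] B[OF k] x
        by (cases b; simp add: poly_approximation_def partial_decision_procedure_def)+
      show "x \<in> (A - B) \<union> (B - A)" if "tm_result P ([?w] @ [x]) = Some [True]"
        using that xor(3)[OF x x, of True] in_A in_B by auto
      show "x \<notin> (A - B) \<union> (B - A)" if "tm_result P ([?w] @ [x]) = Some [False]"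
        using that xor(3)[OF x x, of False] in_A in_B by auto
    qed
    \<comment> \<open>The explicit time bound also gives the asymptotic one, with constant
      \<open>g k\<close>.\<close>
    ultimately show ?thesis
      using time xor(1) unfolding poly_approximation_def by auto
  qed
  show ?thesis unfolding in_FPT_def using P g main by blast
qed

theorem theorem19:
  fixes A B :: "word set"
  assumes "A \<subseteq> nonempty_words" and "B \<subseteq> nonempty_words"
    and "(FPT_parameterizations A :: ('k parameter_space \<times> (word \<times> 'k) set) set)
           = FPT_parameterizations B"
  shows "(FPT_parameterizations A :: ('k parameter_space \<times> (word \<times> 'k) set) set)
           \<subseteq> FPT_parameterizations ((A - B) \<union> (B - A))"
proof
  fix p :: "'k parameter_space \<times> (word \<times> 'k) set"
  assume "p \<in> FPT_parameterizations A"
  \<comment> \<open>The same space and the same \<eta> now have deciders for both \<open>A\<close>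
    and \<open>B\<close>.\<close>
  moreover from this have "p \<in> FPT_parameterizations B" using assms(3) by simp
  ultimately show "p \<in> FPT_parameterizations ((A - B) \<union> (B - A))"
    using in_FPT_symmetric_difference by (auto simp: FPT_parameterizations_def)
qed

end
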